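(* For every name $Q$: if $\eta\,Q\,\mathit{Region}$, then there exists $R$ with $\eta\,R\,(klass\,(\mathit{InteriorPoint}\,Q))$.
   Context: Setting: a Coq formalization (classical logic) of Leśniewski's Ontology and Mereology extended with Tarski's geometry of solids. Names form a type $N$ with a primitive relation $\eta:N\to N\to\mathrm{Prop}$ satisfying Leśniewski's ontological axiom $\eta\,A\,b \leftrightarrow ((\exists C,\eta\,C\,A)\wedge(\forall C\,D,\eta\,C\,A\wedge\eta\,D\,A\to\eta\,C\,D)\wedge(\forall C,\eta\,C\,A\to\eta\,C\,b))$; $A$ is an individual iff $\eta\,A\,A$; $a\subseteq b$ means $\forall P,\eta\,P\,a\to\eta\,P\,b$. Mereology: $pt:N\to N$ ($\eta\,B\,(pt\,A)$: $B$ is a part of $A$) satisfying Leśniewski's mereology axioms (part-of a partial order on individuals; every non-empty name has a unique m-class). M-class: $\eta\,A\,(klass\,a)$ iff $\eta\,A\,A$, $\forall B,\eta\,B\,a\to\eta\,B\,(pt\,A)$, and $\forall B,\eta\,B\,(pt\,A)\to\exists C\,D,\eta\,C\,a\wedge\eta\,D\,(pt\,C)\wedge\eta\,D\,(pt\,B)$. $X$ is exterior to $Y$ iff they have no common part. Geometry: $\mathit{balls}$ is a primitive name (there exists at least one ball). Tarski's definitions for balls: $A$ is externally tangent to $B$ iff $A$ is exterior to $B$ and for any balls $X,Y$ both having $A$ as part and both exterior to $B$, one of $X,Y$ is part of the other; $A$ is internally tangent to $B$ iff $A$ is a proper part of $B$ and for any balls $X,Y$ both having $A$ as a part and both parts of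 $B$, one of $X,Y$ is part of the other; $A,B$ are externally diametrical w.r.t. $C$ iff both are externally tangent to $C$ and for any balls $X,Y$ exterior to $C$ with $A$ part of $X$ and $B$ part of $Y$, $X$ is exterior to $Y$; $A,B$ are internally diametrical w.r.t. $C$ iff both are internally tangent to $C$ and for any balls $X,Y$ externally tangent to $C$ with $A$ exterior to $X$ and $B$ exterior to $Y$, $X$ is exterior to $Y$; $A$ is concentric with $B$ iff $A=B$, or $A$ is a proper part of $B$ and any balls $X,Y$ externally diametrical w.r.t. $A$ and internally tangent to $B$ are internally diametrical w.r.t. $B$, or the same holds with $A,B$ interchanged. $\eta\,P\,(\mathit{Concent}\,Q)$ iff $P,Q$ are balls and $P$ is concentric with $Q$. Point: $\eta\,P\,(\mathit{Point}\,Q)$ iff $\eta\,P\,\mathit{balls}\wedge\eta\,Q\,\mathit{balls}\wedge\eta\,P\,(\mathit{Concent}\,Q)$. Region: $\eta\,P\,\mathit{Region}$ iff $\eta\,P\,P$ and $\exists b,\ b\subseteq\mathit{balls}\wedge\eta\,P\,(klass\,b)$. Interior point: $\eta\,P\,(\mathit{InteriorPoint}\,Q)$ iff $\eta\,Q\,\mathit{Region}$ and $\exists P',\ \eta\,P\,(\mathit{Point}\,P')\wedge\eta\,P'\,(pt\,Q)$. *)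

theory Defs
  imports Main
begin

locale lesniewski_ontology =
  fixes \<eta> :: "'n \<Rightarrow> 'n \<Rightarrow> bool"
  assumes ontological_axiom:
    "\<eta> A b \<longleftrightarrow>
      (\<exists>C. \<eta> C A) \<and>
      (\<forall>C D. \<eta> C A \<and> \<eta> D A \<longrightarrow> \<eta> C D) \<and>
      (\<forall>C. \<eta> C A \<longrightarrow> \<eta> C b)"
begin

definition individual :: "'n \<Rightarrow> bool" where
  "individual A \<longleftrightarrow> \<eta> A A"

text \<open>
  Identity of individuals is Lesniewski's singular identity. HOL equality on \<^typ>\<open>'n\<close> would be
  too fine: the ontological axiom does not make names extensional, so two HOL-distinct names may
  denote the same individual.
\<close>

definition same :: "'n \<Rightarrow> 'n \<Rightarrow> bool" where
  "same A B \<longleftrightarrow> \<eta> A B \<and> \<eta> B A"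

definition included :: "'n \<Rightarrow> 'n \<Rightarrow> bool" where
  "included a b \<longleftrightarrow> (\<forall>P. \<eta> P a \<longrightarrow> \<eta> P b)"

end

text \<open>
  In Lesniewski's systems a definition of a name (or name-forming functor) is an equivalence
  \<open>\<eta> P (F Q) \<longleftrightarrow> \<dots>\<close> adjoined to the system. Since \<^typ>\<open>'n\<close> is abstract, such functors are locale
  parameters whose defining equivalences are locale assumptions (named \<open>_def\<close>). The part relation
  \<open>pt\<close> is the improper (reflexive) one.
\<close>

locale lesniewski_mereology = lesniewski_ontology \<eta>
  for \<eta> :: "'n \<Rightarrow> 'n \<Rightarrow> bool" +
  fixes pt :: "'n \<Rightarrow> 'n"
    and klass :: "'n \<Rightarrow> 'n"
  assumes klass_def:
      "\<eta> A (klass a) \<longleftrightarrow>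
        individual A \<and>
        (\<forall>B. \<eta> B a \<longrightarrow> \<eta> B (pt A)) \<and>
        (\<forall>B. \<eta> B (pt A) \<longrightarrow> (\<exists>C D. \<eta> C a \<and> \<eta> D (pt C) \<and> \<eta> D (pt B)))"
    and pt_whole_individual: "\<eta> A (pt B) \<Longrightarrow> individual B"
    and pt_refl: "individual A \<Longrightarrow> \<eta> A (pt A)"
    and pt_antisym: "\<eta> A (pt B) \<Longrightarrow> \<eta> B (pt A) \<Longrightarrow> same A B"
    and pt_trans: "\<eta> A (pt B) \<Longrightarrow> \<eta> B (pt C) \<Longrightarrow> \<eta> A (pt C)"
    and klass_exists: "\<eta> A a \<Longrightarrow> \<exists>K. \<eta> K (klass a)"
    and klass_unique: "\<eta> A (klass a) \<Longrightarrow> \<eta> B (klass a) \<Longrightarrow> same A B"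
begin

definition proper_part :: "'n \<Rightarrow> 'n \<Rightarrow> bool" where
  "proper_part A B \<longleftrightarrow> \<eta> A (pt B) \<and> \<not> same A B"

definition exterior :: "'n \<Rightarrow> 'n \<Rightarrow> bool" where
  "exterior A B \<longleftrightarrow> \<not> (\<exists>Z. \<eta> Z (pt A) \<and> \<eta> Z (pt B))"

end

text \<open>The relations in the next locale are meant for, and only ever applied to, balls.\<close>

locale tarski_balls = lesniewski_mereology \<eta> pt klass
  for \<eta> :: "'n \<Rightarrow> 'n \<Rightarrow> bool" and pt :: "'n \<Rightarrow> 'n" and klass :: "'n \<Rightarrow> 'n" +
  fixes balls :: 'n
  assumes ball_exists: "\<exists>B. \<eta> B balls"
begin

definition externally_tangent :: "'n \<Rightarrow> 'n \<Rightarrow> bool" where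
  "externally_tangent A B \<longleftrightarrow>
    exterior A B \<and>
    (\<forall>X Y. \<eta> X balls \<and> \<eta> Y balls \<and> \<eta> A (pt X) \<and> \<eta> A (pt Y) \<and> exterior X B \<and> exterior Y B
      \<longrightarrow> \<eta> X (pt Y) \<or> \<eta> Y (pt X))"

definition internally_tangent :: "'n \<Rightarrow> 'n \<Rightarrow> bool" where
  "internally_tangent A B \<longleftrightarrow>
    proper_part A B \<and>
    (\<forall>X Y. \<eta> X balls \<and> \<eta> Y balls \<and> \<eta> A (pt X) \<and> \<eta> A (pt Y) \<and> \<eta> X (pt B) \<and> \<eta> Y (pt B)
      \<longrightarrow> \<eta> X (pt Y) \<or> \<eta> Y (pt X))"

definition externally_diametrical :: "'n \<Rightarrow> 'n \<Rightarrow> 'n \<Rightarrow> bool" where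
  "externally_diametrical A B C \<longleftrightarrow>
    externally_tangent A C \<and> externally_tangent B C \<and>
    (\<forall>X Y. \<eta> X balls \<and> \<eta> Y balls \<and> exterior X C \<and> exterior Y C \<and> \<eta> A (pt X) \<and> \<eta> B (pt Y)
      \<longrightarrow> exterior X Y)"

definition internally_diametrical :: "'n \<Rightarrow> 'n \<Rightarrow> 'n \<Rightarrow> bool" where
  "internally_diametrical A B C \<longleftrightarrow>
    internally_tangent A C \<and> internally_tangent B C \<and>
    (\<forall>X Y. \<eta> X balls \<and> \<eta> Y balls \<and> externally_tangent X C \<and> externally_tangent Y C \<and>
        exterior A X \<and> exterior B Y
      \<longrightarrow> exterior X Y)"

definition concentric_within :: "'n \<Rightarrow> 'n \<Rightarrow> bool" where
  "concentric_within A B \<longleftrightarrow>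
    proper_part A B \<and>
    (\<forall>X Y. \<eta> X balls \<and> \<eta> Y balls \<and> externally_diametrical X Y A \<and>
        internally_tangent X B \<and> internally_tangent Y B
      \<longrightarrow> internally_diametrical X Y B)"

definition concentric :: "'n \<Rightarrow> 'n \<Rightarrow> bool" where
  "concentric A B \<longleftrightarrow> same A B \<or> concentric_within A B \<or> concentric_within B A"

end

locale tarski_solids = tarski_balls \<eta> pt klass balls
  for \<eta> :: "'n \<Rightarrow> 'n \<Rightarrow> bool" and pt :: "'n \<Rightarrow> 'n" and klass :: "'n \<Rightarrow> 'n" and balls :: 'n +
  fixes Concent :: "'n \<Rightarrow> 'n"
    and Point :: "'n \<Rightarrow> 'n"
    and Region :: 'n
    and InteriorPoint :: "'n \<Rightarrow> 'n"
  assumes Concent_def: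
      "\<eta> P (Concent Q) \<longleftrightarrow> \<eta> P balls \<and> \<eta> Q balls \<and> concentric P Q"
    and Point_def:
      "\<eta> P (Point Q) \<longleftrightarrow> \<eta> P balls \<and> \<eta> Q balls \<and> \<eta> P (Concent Q)"
    and Region_def:
      "\<eta> P Region \<longleftrightarrow> individual P \<and> (\<exists>b. included b balls \<and> \<eta> P (klass b))"
    and InteriorPoint_def:
      "\<eta> P (InteriorPoint Q) \<longleftrightarrow> \<eta> Q Region \<and> (\<exists>P'. \<eta> P (Point P') \<and> \<eta> P' (pt Q))"

end

theory Submission
  imports Defs
begin

text \<open>
  A region is a part of itself, so the m-class condition provides a ball in it. That ball is
  concentric with itself, hence an interior point, and a non-empty name has an m-class.
\<close>

text \<open>The first two conjuncts of the axiom for \<open>\<eta> A b\<close> do not mention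
  \<open>b\<close>, and the third is trivial when \<open>b\<close> is \<open>A\<close>.\<close>

lemma (in lesniewski_ontology) eta_self:
  assumes "\<eta> A b"
  shows "\<eta> A A"
  using assms ontological_axiom[of A b] ontological_axiom[of A A] by blast

lemma (in tarski_balls) concentric_refl:
  assumes "\<eta> B b"
  shows "concentric B B"
  using eta_self[OF assms] by (simp add: concentric_def same_def)

lemma (in tarski_solids) region_contains_ball:
  assumes "\<eta> Q Region"
  obtains B where "\<eta> B balls" "\<eta> B (pt Q)"
proof -
  obtain b where "individual Q" and b: "included b balls" "\<eta> Q (klass b)"
    using assms Region_def by blast
  \<comment> \<open>The third conjunct of \<open>klass_def\<close>, taken at \<open>Q\<close> as a
    part of \<open>Q\<close>, yields a member of \<open>b\<close>.\<close>
  then obtain B where "\<eta> B b"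
    using pt_refl klass_def by blast
  \<comment> \<open>By the second conjunct, members of \<open>b\<close> are parts of
    \<open>Q\<close>.\<close>
  with b that show thesis
    using klass_def included_def by blast
qed

lemma (in tarski_solids) ball_part_interior_point:
  assumes "\<eta> Q Region" "\<eta> B balls" "\<eta> B (pt Q)"
  shows "\<eta> B (InteriorPoint Q)"
  \<comment> \<open>The witness for \<open>P'\<close> is \<open>B\<close> itself.\<close>
  using assms concentric_refl Concent_def Point_def InteriorPoint_def by blast

theorem theorem3:
  fixes \<eta> :: "'n \<Rightarrow> 'n \<Rightarrow> bool"
    and pt klass Concent Point InteriorPoint :: "'n \<Rightarrow> 'n"
    and balls Region :: 'n
  assumes "tarski_solids \<eta> pt klass balls Concent Point Region InteriorPoint"
  shows "\<forall>Q. \<eta> Q Region \<longrightarrow> (\<exists>R. \<eta> R (klass (InteriorPoint Q)))"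
proof -
  interpret tarski_solids \<eta> pt klass balls Concent Point Region InteriorPoint
    by (fact assms)
  show ?thesis
    using region_contains_ball ball_part_interior_point klass_exists by metis
qed

end
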